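(* Let $a,b\in\mathbb{C}$ with $|a|^2+|b|^2=1$ and $|\eta\rangle=a|00\rangle+b|11\rangle$. For every integer $x\ge 1$, the output $|A_x\rangle$ of $x$ successive entanglement swaps on a chain of $x+1$ copies of $|\eta\rangle$ follows a (folded) binomial distribution: for each integer $n$ with $0\le n<\frac{x+1}{2}$, $$|A_x\rangle=|\eta_{x+1-2n}\rangle\ \text{ with probability }\ \binom{x+1}{n}\left(|a|^{2(x+1-n)}|b|^{2n}+|a|^{2n}|b|^{2(x+1-n)}\right),$$ and, if $x$ is odd, $$|A_x\rangle=|\eta_0\rangle\ \text{ with probability }\ \binom{x+1}{\frac{x+1}{2}}|a|^{x+1}|b|^{x+1}.$$
   Context: For $m\in\{0,1,2,\dots\}$ put $n_m=\sqrt{|a|^{2m}+|b|^{2m}}$ (with $0^0=1$) and $|\eta_m\rangle=\frac{a^m|00\rangle+b^m|11\rangle}{n_m}$, so $|\eta_1\rangle=|\eta\rangle$ and $|\eta_0\rangle=(|00\rangle+|11\rangle)/\sqrt2$. The entanglement swap map $S$ acts on $|\eta_m\rangle\otimes|\eta_p\rangle$ (qubits 1,2 carry $|\eta_m\rangle$, qubits 3,4 carry $|\eta_p\rangle$) as follows: apply CNOT with control qubit 2 and target qubit 3; apply a Hadamard gate to qubit 2; measure qubits 2 and 3 in the computational basis, with outcomes $s,t\in\{0,1\}$; apply $Z^s$ to qubit 1 and $X^t$ to qubit 4. The output is the resulting (random) state of qubits 1 and 4. States are identified when they agree up to a global phase and up to the simultaneous bit flip $X\otimes X$ (equivalently, in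 a swap the state of larger index is placed first). The outcomes $s,t$ are not recorded, so the output of $S$ is a random pure two-qubit state, described by listing the possible states with their probabilities; these labels are formal, i.e. the probability attached to label $|\eta_k\rangle$ is the total probability of the measurement outcomes giving index $k$ (outcome $t=0$ gives index $m+p$, outcome $t=1$ gives index $|m-p|$). In particular $S(|\eta_0\rangle\otimes|\eta\rangle)=|\eta\rangle$ with certainty. When $S$ is applied to a random state $|A\rangle\otimes|\eta\rangle$, the output is obtained by first sampling $|A\rangle$ and then performing the swap with independent measurement randomness. The chain is defined by $|A_0\rangle=|\eta\rangle$ and $|A_{k}\rangle=S(|A_{k-1}\rangle\otimes|\eta\rangle)$ for $k\ge1$. *)

theory Defs
  imports "HOL-Probability.Probability"
begin

text \<open>
  Qubits are indexed by \<open>bool\<close>, with \<open>False\<close> for the basis state 0 and \<open>True\<close> for 1.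
  Multi-qubit states are complex coordinate vectors over tuples of bits, qubit 1 first;
  the norm on these types is the Euclidean (Hilbert space) norm.
\<close>

type_synonym qubits2 = "complex ^ (bool \<times> bool)"
type_synonym qubits4 = "complex ^ (bool \<times> bool \<times> bool \<times> bool)"
type_synonym gate = "complex ^ bool ^ bool"

definition ket :: "bool \<Rightarrow> bool \<Rightarrow> qubits2"
  where "ket i j = axis (i, j) 1"

definition hadamard :: gate
  where "hadamard = (\<chi> i j. (if i \<and> j then - 1 else 1) / complex_of_real (sqrt 2))"

definition pauli_X :: gate
  where "pauli_X = (\<chi> i j. if i \<noteq> j then 1 else 0)"

definition pauli_Z :: gate
  where "pauli_Z = (\<chi> i j. if i = j then (if i then - 1 else 1) else 0)"

definition gate_if :: "gate \<Rightarrow> bool \<Rightarrow> gate"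
  where "gate_if U s = (if s then U else mat 1)"

definition apply2 :: "gate \<Rightarrow> gate \<Rightarrow> qubits2 \<Rightarrow> qubits2"
  where "apply2 U V \<psi> =
    vec_lambda (\<lambda>(i, j). \<Sum>i'\<in>UNIV. \<Sum>j'\<in>UNIV. U $ i $ i' * V $ j $ j' * \<psi> $ (i', j'))"

definition tensor :: "qubits2 \<Rightarrow> qubits2 \<Rightarrow> qubits4"
  where "tensor \<psi> \<phi> = vec_lambda (\<lambda>(q1, q2, q3, q4). \<psi> $ (q1, q2) * \<phi> $ (q3, q4))"

text \<open>CNOT is an involution, so the amplitude at a basis state is read off at its image.\<close>

definition cnot23 :: "qubits4 \<Rightarrow> qubits4"
  where "cnot23 \<Phi> = vec_lambda (\<lambda>(q1, q2, q3, q4). \<Phi> $ (q1, q2, q3 \<noteq> q2, q4))"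

definition hadamard2 :: "qubits4 \<Rightarrow> qubits4"
  where "hadamard2 \<Phi> =
    vec_lambda (\<lambda>(q1, q2, q3, q4). \<Sum>r\<in>UNIV. hadamard $ q2 $ r * \<Phi> $ (q1, r, q3, q4))"

text \<open>
  The unnormalised state of qubits 1 and 4 after qubits 2 and 3 have been found in \<open>s\<close>, \<open>t\<close>.
  Its squared norm is the Born probability of that outcome.
\<close>

definition branch23 :: "qubits4 \<Rightarrow> bool \<times> bool \<Rightarrow> qubits2"
  where "branch23 \<Phi> = (\<lambda>(s, t). vec_lambda (\<lambda>(q1, q4). \<Phi> $ (q1, s, t, q4)))"

definition measure23 :: "qubits4 \<Rightarrow> (bool \<times> bool) pmf"
  where "measure23 \<Phi> = embed_pmf (\<lambda>st. (norm (branch23 \<Phi> st))\<^sup>2)"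

text \<open>The squared norms do form a probability distribution when the state is normalised.\<close>

lemma pmf_measure23:
  assumes "norm \<Phi> = 1"
  shows "pmf (measure23 \<Phi>) st = (norm (branch23 \<Phi> st))\<^sup>2"
proof -
  have "(\<Sum>st\<in>UNIV. (norm (branch23 \<Phi> st))\<^sup>2) = (norm \<Phi>)\<^sup>2"
    unfolding norm_vec_def L2_set_def UNIV_Times_UNIV[symmetric] sum.cartesian_product[symmetric]
    by (simp add: branch23_def UNIV_bool sum_nonneg)
  then have "(\<Sum>st\<in>UNIV. ennreal ((norm (branch23 \<Phi> st))\<^sup>2)) = 1"
    using assms by (simp add: sum_ennreal)
  then show ?thesis
    unfolding measure23_def
    by (intro pmf_embed_pmf) (simp_all add: nn_integral_count_space_finite)
qed

definition eta_norm :: "complex \<Rightarrow> complex \<Rightarrow> nat \<Rightarrow> real"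
  where "eta_norm a b m = sqrt (cmod a ^ (2 * m) + cmod b ^ (2 * m))"

definition eta :: "complex \<Rightarrow> complex \<Rightarrow> nat \<Rightarrow> qubits2"
  where "eta a b m =
    (1 / complex_of_real (eta_norm a b m)) *s (a ^ m *s ket False False + b ^ m *s ket True True)"

text \<open>Equality up to a global phase and up to the simultaneous bit flip.\<close>

definition same_state :: "qubits2 \<Rightarrow> qubits2 \<Rightarrow> bool"
  where "same_state \<psi> \<phi> \<longleftrightarrow>
    (\<exists>c. cmod c = 1 \<and> (\<psi> = c *s \<phi> \<or> \<psi> = c *s apply2 pauli_X pauli_X \<phi>))"

text \<open>
  A labelled state carries its formal index next to the actual state vector. The index is needed
  because the states \<^term>\<open>eta a b m\<close> need not be distinct for distinct \<open>m\<close> (e.g. for \<open>a = b\<close>).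
\<close>

type_synonym labelled_state = "nat \<times> qubits2"

definition is_eta :: "complex \<Rightarrow> complex \<Rightarrow> nat \<Rightarrow> labelled_state \<Rightarrow> bool"
  where "is_eta a b k A \<longleftrightarrow> fst A = k \<and> same_state (snd A) (eta a b k)"

definition swap_circuit :: "qubits2 \<Rightarrow> qubits2 \<Rightarrow> qubits4"
  where "swap_circuit \<psi> \<phi> = hadamard2 (cnot23 (tensor \<psi> \<phi>))"

definition corrected :: "qubits4 \<Rightarrow> bool \<times> bool \<Rightarrow> qubits2"
  where "corrected \<Phi> = (\<lambda>(s, t). apply2 (gate_if pauli_Z s) (gate_if pauli_X t)
    ((1 / complex_of_real (norm (branch23 \<Phi> (s, t)))) *s branch23 \<Phi> (s, t)))"

definition swap_index :: "nat \<Rightarrow> nat \<Rightarrow> bool \<times> bool \<Rightarrow> nat"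
  where "swap_index m p = (\<lambda>(s, t). if t then nat \<bar>int m - int p\<bar> else m + p)"

text \<open>
  The state of larger index is placed first. This fixes representatives modulo the simultaneous
  bit flip: in the other order, outcome \<open>t = 1\<close> would yield the flipped state, on which
  the index rule of a further swap would have the roles of \<open>t = 0\<close> and \<open>t = 1\<close> exchanged.
\<close>

definition ent_swap :: "labelled_state \<Rightarrow> labelled_state \<Rightarrow> labelled_state pmf"
  where "ent_swap = (\<lambda>(m, \<psi>) (p, \<phi>).
    let \<Phi> = (if p \<le> m then swap_circuit \<psi> \<phi> else swap_circuit \<phi> \<psi>)
    in map_pmf (\<lambda>st. (swap_index m p st, corrected \<Phi> st)) (measure23 \<Phi>))"

definition eta_copy :: "complex \<Rightarrow> complex \<Rightarrow> labelled_state"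
  where "eta_copy a b = (1, a *s ket False False + b *s ket True True)"

primrec swap_chain :: "complex \<Rightarrow> complex \<Rightarrow> nat \<Rightarrow> labelled_state pmf"
  where
    "swap_chain a b 0 = return_pmf (eta_copy a b)"
  | "swap_chain a b (Suc k) = bind_pmf (swap_chain a b k) (\<lambda>A. ent_swap A (eta_copy a b))"

end

theory Submission
  imports Defs
begin

text \<open>
  Every corrected branch of a swap of \<open>c \<cdot> \<eta>\<^sub>m\<close> with \<open>\<eta>\<^sub>1\<close> is a multiple of \<open>a\<^sup>k|00\<rangle> + b\<^sup>k|11\<rangle>\<close> for the
  index \<open>k\<close> attached to its outcome, so the chain is a Markov chain on the indices. For \<open>m > 0\<close> it
  moves from \<open>m\<close> to \<open>m + 1\<close> with probability \<open>n\<^sub>m\<^sub>+\<^sub>1\<^sup>2 / n\<^sub>m\<^sup>2\<close> and to \<open>m - 1\<close> with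
  probability \<open>|ab|\<^sup>2 n\<^sub>m\<^sub>-\<^sub>1\<^sup>2 / n\<^sub>m\<^sup>2\<close>. Dividing the law by \<open>n\<^sub>k\<^sup>2\<close> turns its recursion
  into Pascal's rule.
\<close>

section \<open>Two-qubit states supported on the even-parity basis\<close>

definition diag :: "complex \<Rightarrow> complex \<Rightarrow> qubits2"
  where "diag u v = u *s ket False False + v *s ket True True"

lemma diag_nth [simp]:
  "diag u v $ (i, j) = (if i = j then if i then v else u else 0)"
  by (auto simp: diag_def ket_def axis_def)

lemma vec_eq_bool2_iff:
  fixes \<psi> \<phi> :: qubits2
  shows "\<psi> = \<phi> \<longleftrightarrow> (\<forall>i j. \<psi> $ (i, j) = \<phi> $ (i, j))"
  by (auto simp: vec_eq_iff)

lemma scale_diag: "c *s diag u v = diag (c * u) (c * v)"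
  by (simp add: vec_eq_bool2_iff)

lemma norm_qubits2_sq:
  fixes \<psi> :: qubits2
  shows "(norm \<psi>)\<^sup>2 = (\<Sum>i\<in>UNIV. \<Sum>j\<in>UNIV. (cmod (\<psi> $ (i, j)))\<^sup>2)"
  unfolding norm_vec_def L2_set_def UNIV_Times_UNIV[symmetric] sum.cartesian_product'
  by (simp add: sum_nonneg)

lemma norm_scale_qubits2:
  fixes \<psi> :: qubits2
  shows "norm (c *s \<psi>) = cmod c * norm \<psi>"
  by (simp add: norm_vec_def norm_mult L2_set_right_distrib)

lemma norm_diag_sq: "(norm (diag u v))\<^sup>2 = (cmod u)\<^sup>2 + (cmod v)\<^sup>2"
  by (simp add: norm_qubits2_sq UNIV_bool)

lemma norm_diag: "norm (diag u v) = sqrt ((cmod u)\<^sup>2 + (cmod v)\<^sup>2)"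
  by (metis norm_diag_sq norm_ge_zero real_sqrt_unique)

section \<open>The swap circuit on diagonal states\<close>

text \<open>After the CNOT, outcome \<open>t\<close> forces qubit 4 to equal qubit 1 XOR
  \<open>t\<close>; the Hadamard contributes 1/sqrt 2 and the sign (-1)^s on the component where
  qubit 1 is 1. Writing sign and flip as Z^s and X^t lets the later correction cancel them.\<close>

lemma branch23_swap_circuit_diag:
  "branch23 (swap_circuit (diag u v) (diag u' v')) (s, t) =
    apply2 (gate_if pauli_Z s) (gate_if pauli_X t)
      (diag (u * (if t then v' else u') / complex_of_real (sqrt 2))
            (v * (if t then u' else v') / complex_of_real (sqrt 2)))"
  unfolding vec_eq_bool2_iff
  by (cases s; cases t)
    (auto simp: branch23_def swap_circuit_def hadamard2_def cnot23_def tensor_def apply2_def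
      gate_if_def pauli_X_def pauli_Z_def hadamard_def UNIV_bool mat_def)

text \<open>Z and X are their own inverses; the scalar in between is the normalisation performed by
  \<open>corrected\<close>.\<close>

lemma apply2_correction_involution:
  "apply2 (gate_if pauli_Z s) (gate_if pauli_X t)
     (c *s apply2 (gate_if pauli_Z s) (gate_if pauli_X t) \<psi>) = c *s \<psi>"
  unfolding vec_eq_bool2_iff
  by (cases s; cases t)
    (auto simp: apply2_def gate_if_def pauli_X_def pauli_Z_def UNIV_bool mat_def)

lemma norm_apply2_correction:
  "(norm (apply2 (gate_if pauli_Z s) (gate_if pauli_X t) \<psi>))\<^sup>2 = (norm \<psi>)\<^sup>2"
  unfolding norm_qubits2_sq
  by (cases s; cases t)
    (auto simp: apply2_def gate_if_def pauli_X_def pauli_Z_def UNIV_bool mat_def)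

lemma norm_branch23_swap_circuit_diag:
  "(norm (branch23 (swap_circuit (diag u v) (diag u' v')) (s, t)))\<^sup>2 =
    ((cmod (u * (if t then v' else u')))\<^sup>2 + (cmod (v * (if t then u' else v')))\<^sup>2) / 2"
  unfolding branch23_swap_circuit_diag norm_apply2_correction norm_diag_sq
  by (simp add: norm_divide norm_mult power_divide add_divide_distrib)

lemma norm_qubits4_sq:
  fixes \<Phi> :: qubits4
  shows "(norm \<Phi>)\<^sup>2 = (\<Sum>s\<in>UNIV. \<Sum>t\<in>UNIV. (norm (branch23 \<Phi> (s, t)))\<^sup>2)"
  unfolding norm_vec_def L2_set_def UNIV_Times_UNIV[symmetric] sum.cartesian_product[symmetric]
  by (simp add: branch23_def UNIV_bool sum_nonneg)

text \<open>The outcomes with t = 0 and t = 1 carry the matching and the crossed terms of the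
  product of the two squared norms, each split evenly over \<open>s\<close>.\<close>

lemma norm_swap_circuit_diag:
  "norm (swap_circuit (diag u v) (diag u' v')) = norm (diag u v) * norm (diag u' v')"
proof -
  have "(norm (swap_circuit (diag u v) (diag u' v')))\<^sup>2 = (norm (diag u v) * norm (diag u' v'))\<^sup>2"
    unfolding norm_qubits4_sq norm_branch23_swap_circuit_diag power_mult_distrib norm_diag_sq
    by (simp add: UNIV_bool norm_mult field_simps)
  then show ?thesis
    by (simp add: power2_eq_iff_nonneg)
qed

lemma corrected_swap_circuit_diag:
  "corrected (swap_circuit (diag u v) (diag u' v')) (s, t) =
    (let w = diag (u * (if t then v' else u')) (v * (if t then u' else v'))
     in (1 / complex_of_real (norm w)) *s w)"
proof -
  let ?p = "u * (if t then v' else u')" and ?q = "v * (if t then u' else v')"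
  let ?B = "branch23 (swap_circuit (diag u v) (diag u' v')) (s, t)"
  have "norm ?B = norm (diag ?p ?q) / sqrt 2"
  proof (rule power2_eq_imp_eq)
    show "(norm ?B)\<^sup>2 = (norm (diag ?p ?q) / sqrt 2)\<^sup>2"
      unfolding norm_branch23_swap_circuit_diag power_divide norm_diag_sq by simp
  qed simp_all
  then have "corrected (swap_circuit (diag u v) (diag u' v')) (s, t) =
    (1 / complex_of_real (norm (diag ?p ?q) / sqrt 2)) *s
      diag (?p / complex_of_real (sqrt 2)) (?q / complex_of_real (sqrt 2))"
    unfolding corrected_def prod.case branch23_swap_circuit_diag apply2_correction_involution
    by simp
  then show ?thesis
    by (simp add: scale_diag Let_def)
qed

lemma eta_eq_diag:
  "eta a b m = diag (a ^ m / complex_of_real (eta_norm a b m)) (b ^ m / complex_of_real (eta_norm a b m))"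
  by (simp add: eta_def scale_diag flip: diag_def)

lemma eta_norm_eq_norm: "eta_norm a b m = norm (diag (a ^ m) (b ^ m))"
  by (simp add: eta_norm_def norm_diag norm_power power_mult mult.commute flip: power_mult)

lemma eta_eq_normalized: "eta a b m = (1 / complex_of_real (norm (diag (a ^ m) (b ^ m)))) *s diag (a ^ m) (b ^ m)"
  by (simp add: eta_def eta_norm_eq_norm flip: diag_def)

text \<open>Normalising removes the modulus of a scalar and leaves only its phase c / |c|.\<close>

lemma normalize_scale:
  fixes \<psi> :: qubits2
  assumes "c \<noteq> 0"
  shows "\<exists>d. cmod d = 1 \<and>
    (1 / complex_of_real (norm (c *s \<psi>))) *s (c *s \<psi>) = d *s ((1 / complex_of_real (norm \<psi>)) *s \<psi>)"
proof (intro exI conjI)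
  show "(1 / complex_of_real (norm (c *s \<psi>))) *s (c *s \<psi>) =
      (c / cmod c) *s ((1 / complex_of_real (norm \<psi>)) *s \<psi>)"
    by (simp add: norm_scale_qubits2)
  show "cmod (c / complex_of_real (cmod c)) = 1"
    using assms by (simp add: norm_divide)
qed

section \<open>One swap with a fresh copy\<close>

context
  fixes a b :: complex
  assumes normalized: "(cmod a)\<^sup>2 + (cmod b)\<^sup>2 = 1"
begin

lemma eta_norm_pos: "eta_norm a b m > 0"
proof -
  have "a \<noteq> 0 \<or> b \<noteq> 0"
    using normalized by auto
  then have "cmod a ^ (2 * m) + cmod b ^ (2 * m) > 0"
    by (auto intro: add_pos_nonneg add_nonneg_pos)
  then show ?thesis
    by (simp add: eta_norm_def)
qed

lemma eta_norm_sq: "(eta_norm a b m)\<^sup>2 = cmod a ^ (2 * m) + cmod b ^ (2 * m)"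
  by (simp add: eta_norm_def)

lemma eta_norm_1: "eta_norm a b (Suc 0) = 1"
  using normalized by (simp add: eta_norm_def power2_eq_square)

lemma eta_norm_0: "eta_norm a b 0 = sqrt 2"
  by (simp add: eta_norm_def)

lemma norm_eta: "norm (eta a b m) = 1"
  using eta_norm_pos[of m]
  by (simp add: eta_eq_normalized norm_scale_qubits2 norm_divide eta_norm_eq_norm)

lemma eta_copy_eq: "eta_copy a b = (1, diag a b)"
  by (simp add: eta_copy_def diag_def)

lemma norm_diag_power_sq: "(norm (d *s diag (a ^ k) (b ^ k)))\<^sup>2 = (cmod d)\<^sup>2 * (eta_norm a b k)\<^sup>2"
  by (simp add: norm_scale_qubits2 eta_norm_eq_norm power_mult_distrib)

text \<open>The phase \<open>c\<close> is allowed because the chain preserves \<eta>-states only up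
  to a phase. The \<open>obtains\<close> form ties the law, the branch weights and the corrected
  states to one circuit output \<open>\<Phi>\<close>.\<close>

lemma ent_swap_eta:
  assumes c: "cmod c = 1"
  obtains \<Phi> where "norm \<Phi> = 1"
    and "ent_swap (m, c *s eta a b m) (eta_copy a b) =
      map_pmf (\<lambda>st. (swap_index m 1 st, corrected \<Phi> st)) (measure23 \<Phi>)"
    and "\<And>s t. (norm (branch23 \<Phi> (s, t)))\<^sup>2 =
      (if t \<and> m \<noteq> 0 then (cmod a * cmod b)\<^sup>2 else 1) * (eta_norm a b (swap_index m 1 (s, t)))\<^sup>2
        / (2 * (eta_norm a b m)\<^sup>2)"
    and "\<And>s t. branch23 \<Phi> (s, t) \<noteq> 0 \<Longrightarrow>
      \<exists>d. cmod d = 1 \<and> corrected \<Phi> (s, t) = d *s eta a b (swap_index m 1 (s, t))"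
proof -
  define \<kappa> where "\<kappa> = c / complex_of_real (eta_norm a b m)"
  define \<psi> where "\<psi> = diag (\<kappa> * a ^ m) (\<kappa> * b ^ m)"
  define \<Phi> where "\<Phi> = (if 1 \<le> m then swap_circuit \<psi> (diag a b) else swap_circuit (diag a b) \<psi>)"
  \<comment> \<open>For t = 1 and m > 0, a^m b = (ab) a^(m-1) and b^m a = (ab) b^(m-1). At m = 0 the
    index goes up to 1, so no factor ab splits off.\<close>
  define d where "d t = \<kappa> * (if t \<and> m \<noteq> 0 then a * b else 1)" for t
  define w where "w s t = d t *s diag (a ^ swap_index m 1 (s, t)) (b ^ swap_index m 1 (s, t))" for s t
  have \<psi>: "c *s eta a b m = \<psi>"
    by (simp add: eta_eq_diag scale_diag \<psi>_def \<kappa>_def)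
  have "norm (diag a b) = 1"
    by (simp add: norm_diag normalized)
  moreover have "norm \<psi> = 1"
    unfolding \<psi>[symmetric] by (simp add: norm_scale_qubits2 norm_eta c)
  ultimately have norm_\<Phi>: "norm \<Phi> = 1"
    unfolding \<Phi>_def \<psi>_def by (simp add: norm_swap_circuit_diag)
  have w: "w s t = (if 1 \<le> m
      then diag (\<kappa> * a ^ m * (if t then b else a)) (\<kappa> * b ^ m * (if t then a else b))
      else diag (a * (if t then \<kappa> * b ^ m else \<kappa> * a ^ m)) (b * (if t then \<kappa> * a ^ m else \<kappa> * b ^ m)))" for s t
    by (cases m) (auto simp: w_def d_def scale_diag swap_index_def nat_add_distrib mult_ac)
  have branch: "(norm (branch23 \<Phi> (s, t)))\<^sup>2 = (norm (w s t))\<^sup>2 / 2" for s t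
    unfolding w \<Phi>_def \<psi>_def by (simp add: norm_branch23_swap_circuit_diag norm_diag_sq)
  have corr: "corrected \<Phi> (s, t) = (1 / complex_of_real (norm (w s t))) *s w s t" for s t
    unfolding w \<Phi>_def \<psi>_def by (simp add: corrected_swap_circuit_diag Let_def)
  show ?thesis
  proof (rule that[of \<Phi>])
    show "ent_swap (m, c *s eta a b m) (eta_copy a b) =
        map_pmf (\<lambda>st. (swap_index m 1 st, corrected \<Phi> st)) (measure23 \<Phi>)"
      by (simp add: ent_swap_def eta_copy_eq \<psi> \<Phi>_def Let_def)
    show "(norm (branch23 \<Phi> (s, t)))\<^sup>2 =
      (if t \<and> m \<noteq> 0 then (cmod a * cmod b)\<^sup>2 else 1) * (eta_norm a b (swap_index m 1 (s, t)))\<^sup>2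
        / (2 * (eta_norm a b m)\<^sup>2)" for s t
      using c by (simp add: branch w_def norm_diag_power_sq d_def \<kappa>_def norm_mult norm_divide
          power_mult_distrib power_divide)
    show "\<exists>d. cmod d = 1 \<and> corrected \<Phi> (s, t) = d *s eta a b (swap_index m 1 (s, t))"
      if "branch23 \<Phi> (s, t) \<noteq> 0" for s t
    proof -
      \<comment> \<open>If ab = 0, the outcome t = 1 at m > 0 has a zero branch with no state to
        normalise; a nonzero branch excludes this.\<close>
      have "d t \<noteq> 0"
        using that branch[of s t] by (auto simp: w_def)
      then show ?thesis
        unfolding corr w_def eta_eq_normalized by (rule normalize_scale)
    qed
  qed (fact norm_\<Phi>)
qed

lemma ent_swap_eta_support:
  assumes "cmod c = 1" and "A \<in> set_pmf (ent_swap (m, c *s eta a b m) (eta_copy a b))"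
  shows "\<exists>d. cmod d = 1 \<and> snd A = d *s eta a b (fst A)"
proof -
  obtain \<Phi> where \<Phi>: "norm \<Phi> = 1"
    "ent_swap (m, c *s eta a b m) (eta_copy a b) =
      map_pmf (\<lambda>st. (swap_index m 1 st, corrected \<Phi> st)) (measure23 \<Phi>)"
    "\<And>s t. branch23 \<Phi> (s, t) \<noteq> 0 \<Longrightarrow>
      \<exists>d. cmod d = 1 \<and> corrected \<Phi> (s, t) = d *s eta a b (swap_index m 1 (s, t))"
    by (rule ent_swap_eta[OF assms(1), of m]) (rule that)
  from assms(2) obtain s t where st: "(s, t) \<in> set_pmf (measure23 \<Phi>)"
      "A = (swap_index m 1 (s, t), corrected \<Phi> (s, t))"
    unfolding \<Phi>(2) by auto
  have "branch23 \<Phi> (s, t) \<noteq> 0"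
    using st(1) by (auto simp: set_pmf_iff pmf_measure23[OF \<Phi>(1)])
  then show ?thesis
    using \<Phi>(3) st(2) by simp
qed

text \<open>At index 0 both values of \<open>t\<close> lead to index 1; the general formula would
  count only one of them and give 1/2.\<close>

definition index_transition :: "nat \<Rightarrow> nat \<Rightarrow> real" where
  "index_transition m k =
    (if m = 0 then of_bool (k = 1)
     else (of_bool (k = m + 1) + of_bool (k + 1 = m) * (cmod a * cmod b)\<^sup>2)
       * (eta_norm a b k)\<^sup>2 / (eta_norm a b m)\<^sup>2)"

text \<open>The two values of \<open>s\<close> have equal weight, which cancels the 1/2 in the
  branch norms. The result is free of \<open>c\<close>, so the next index depends on the current
  index alone.\<close>

lemma pmf_fst_ent_swap_eta:
  assumes "cmod c = 1"
  shows "pmf (map_pmf fst (ent_swap (m, c *s eta a b m) (eta_copy a b))) k = index_transition m k"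
proof -
  obtain \<Phi> where \<Phi>: "norm \<Phi> = 1"
    "ent_swap (m, c *s eta a b m) (eta_copy a b) =
      map_pmf (\<lambda>st. (swap_index m 1 st, corrected \<Phi> st)) (measure23 \<Phi>)"
    "\<And>s t. (norm (branch23 \<Phi> (s, t)))\<^sup>2 =
      (if t \<and> m \<noteq> 0 then (cmod a * cmod b)\<^sup>2 else 1) * (eta_norm a b (swap_index m 1 (s, t)))\<^sup>2
        / (2 * (eta_norm a b m)\<^sup>2)"
    by (rule ent_swap_eta[OF assms, of m]) (rule that)
  have "pmf (map_pmf fst (ent_swap (m, c *s eta a b m) (eta_copy a b))) k =
      measure (measure23 \<Phi>) (swap_index m 1 -` {k})"
    unfolding \<Phi>(2) map_pmf_comp by (simp add: pmf_map)
  also have "\<dots> = (\<Sum>st\<in>swap_index m 1 -` {k}. pmf (measure23 \<Phi>) st)"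
    by (simp add: measure_measure_pmf_finite)
  also have "\<dots> = (\<Sum>st\<in>UNIV. if swap_index m 1 st = k then pmf (measure23 \<Phi>) st else 0)"
    by (simp add: sum.If_cases vimage_def)
  also have "\<dots> = (\<Sum>s\<in>UNIV. \<Sum>t\<in>UNIV.
      if swap_index m 1 (s, t) = k then (norm (branch23 \<Phi> (s, t)))\<^sup>2 else 0)"
    unfolding UNIV_Times_UNIV[symmetric] sum.cartesian_product' pmf_measure23[OF \<Phi>(1)] ..
  also have "\<dots> = index_transition m k"
    using eta_norm_1 eta_norm_0
    by (cases m) (auto simp: \<Phi>(3) UNIV_bool swap_index_def index_transition_def nat_add_distrib)
  finally show ?thesis .
qed

section \<open>The index chain and its law\<close>

lemma swap_chain_support:
  "A \<in> set_pmf (swap_chain a b x) \<Longrightarrow> \<exists>c. cmod c = 1 \<and> snd A = c *s eta a b (fst A)"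
proof (induction x arbitrary: A)
  case 0
  then have "A = (1, diag a b)"
    by (simp add: eta_copy_eq)
  then show ?case
    by (intro exI[of _ 1]) (simp add: eta_eq_diag eta_norm_1)
next
  case (Suc x)
  then obtain B where B: "B \<in> set_pmf (swap_chain a b x)" "A \<in> set_pmf (ent_swap B (eta_copy a b))"
    by auto
  from Suc.IH[OF B(1)] obtain c where "cmod c = 1" "B = (fst B, c *s eta a b (fst B))"
    by (metis prod.collapse)
  then show ?case
    using B(2) by (metis ent_swap_eta_support)
qed

definition swap_chain_index :: "nat \<Rightarrow> nat pmf" where
  "swap_chain_index x = map_pmf fst (swap_chain a b x)"

text \<open>On the support the label already determines the state up to a phase, so the event
  depends on the label only.\<close>

lemma prob_swap_chain_is_eta:
  "measure_pmf.prob (swap_chain a b x) {A. is_eta a b k A} = pmf (swap_chain_index x) k"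
proof -
  have "measure_pmf.prob (swap_chain a b x) {A. is_eta a b k A} =
      measure_pmf.prob (swap_chain a b x) (fst -` {k})"
  proof (intro measure_eq_AE)
    show "AE A in measure_pmf (swap_chain a b x). A \<in> {A. is_eta a b k A} \<longleftrightarrow> A \<in> fst -` {k}"
      unfolding AE_measure_pmf_iff using swap_chain_support
      by (fastforce simp: is_eta_def same_state_def)
  qed simp_all
  then show ?thesis
    by (simp add: swap_chain_index_def pmf_map)
qed

lemma pmf_swap_chain_index_Suc:
  "pmf (swap_chain_index (Suc x)) k =
    (\<Sum>m\<in>{k - 1, k + 1}. index_transition m k * pmf (swap_chain_index x) m)"
proof -
  define J where "J m = map_pmf fst (ent_swap (m, 1 *s eta a b m) (eta_copy a b))" for m
  have J: "pmf (J m) k = index_transition m k" for m k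
    unfolding J_def by (rule pmf_fst_ent_swap_eta) simp
  have "swap_chain_index (Suc x) =
      bind_pmf (swap_chain a b x) (\<lambda>A. map_pmf fst (ent_swap A (eta_copy a b)))"
    by (simp add: swap_chain_index_def map_bind_pmf)
  \<comment> \<open>Phase independence allows replacing each reachable state by the representative
    with phase 1.\<close>
  also have "\<dots> = bind_pmf (swap_chain a b x) (\<lambda>A. J (fst A))"
  proof (intro bind_pmf_cong refl pmf_eqI)
    fix A k assume "A \<in> set_pmf (swap_chain a b x)"
    then obtain c where "cmod c = 1" "A = (fst A, c *s eta a b (fst A))"
      by (metis swap_chain_support prod.collapse)
    then show "pmf (map_pmf fst (ent_swap A (eta_copy a b))) k = pmf (J (fst A)) k"
      by (metis J pmf_fst_ent_swap_eta)
  qed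
  also have "\<dots> = bind_pmf (swap_chain_index x) J"
    by (simp add: swap_chain_index_def bind_map_pmf)
  finally have "pmf (swap_chain_index (Suc x)) k =
      measure_pmf.expectation (swap_chain_index x) (\<lambda>m. index_transition m k)"
    by (simp add: pmf_bind J)
  \<comment> \<open>Only neighbours of \<open>k\<close> can reach it. For k = 0 truncated
    subtraction puts 0 itself into the set, with transition probability 0.\<close>
  also have "\<dots> = (\<Sum>m\<in>{k - 1, k + 1}. index_transition m k * pmf (swap_chain_index x) m)"
    by (subst integral_measure_pmf_real[where A = "{k - 1, k + 1}"])
      (auto simp: index_transition_def split: if_splits)
  finally show ?thesis .
qed

text \<open>At index 0 the two folded binomial terms are one and the same, so the factor
  \<open>(eta_norm a b 0)\<^sup>2 = 2\<close> must not appear.\<close>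

lemma pmf_swap_chain_index:
  "pmf (swap_chain_index x) k =
    (if k \<le> x + 1 \<and> even (x + 1 - k)
     then real ((x + 1) choose ((x + 1 - k) div 2)) * (cmod a * cmod b) ^ (x + 1 - k)
       * (if k = 0 then 1 else (eta_norm a b k)\<^sup>2)
     else 0)"
proof (induction x arbitrary: k)
  case 0
  show ?case
    by (auto simp: swap_chain_index_def eta_copy_def eta_norm_1 le_Suc_eq)
next
  case (Suc x)
  have pos: "eta_norm a b m \<noteq> 0" for m
    using eta_norm_pos[of m] by simp
  \<comment> \<open>In the last case \<open>n\<close> is the lower binomial index of the claim for
    \<open>Suc x\<close>.\<close>
  consider "k > x + 2" | "k \<le> x + 2" "odd (x + 2 - k)" | n where "x + 2 = k + 2 * n"
    by (metis add_diff_inverse_nat evenE linorder_not_less add.commute)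
  then show ?case
  proof cases
    case 1
    then show ?thesis
      by (auto simp: pmf_swap_chain_index_Suc Suc.IH)
  next
    case 2
    then show ?thesis
      by (auto simp: pmf_swap_chain_index_Suc Suc.IH index_transition_def)
  next
    case 3
    show ?thesis
    proof (cases k)
      case 0
      then obtain l where l: "n = Suc l" "x = 2 * l"
        using 3 by (cases n) auto
      \<comment> \<open>The two Pascal terms coincide by symmetry; the resulting 2 is the factor
        n_0^2 of the transition from 1 to 0.\<close>
      have "(2 * l + 2) choose (l + 1) = 2 * ((2 * l + 1) choose l)"
        using binomial_symmetric[of l "2 * l + 1"] by simp
      then show ?thesis
        using 0 l(1) eta_norm_1 eta_norm_0
        by (simp add: l(2) pmf_swap_chain_index_Suc Suc.IH[unfolded l(2)] index_transition_def
            power2_eq_square)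
    next
      case [simp]: (Suc k')
      show ?thesis
      proof (cases n)
        case 0
        then have [simp]: "k' = Suc x"
          using 3 by simp
        \<comment> \<open>The top index is reached only from the previous top index.\<close>
        show ?thesis
          using pos[of k']
          by (simp add: pmf_swap_chain_index_Suc Suc.IH index_transition_def)
      next
        case (Suc l)
        let ?C = "(cmod a * cmod b) ^ (2 * n) * (eta_norm a b k)\<^sup>2"
        have x: "x = k' + 1 + 2 * l"
          using 3 Suc by simp
        \<comment> \<open>For k' = 0 neither the law nor the transition contains n_0^2, and n_1 = 1
          makes the formula agree.\<close>
        have "index_transition k' k * pmf (swap_chain_index x) k' = real ((x + 1) choose n) * ?C"
          unfolding Suc.IH using pos[of k'] x Suc eta_norm_1 by (simp add: index_transition_def)
        \<comment> \<open>The downward step supplies the missing |ab|^2, raising the exponent from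
          2l to 2n.\<close>
        moreover have "index_transition (k + 1) k * pmf (swap_chain_index x) (k + 1) =
            real ((x + 1) choose l) * ?C"
          unfolding Suc.IH using pos[of "k + 1"] x Suc
          by (simp add: index_transition_def power2_eq_square)
        moreover have "(x + 2) choose n = ((x + 1) choose l) + ((x + 1) choose n)"
          using Suc by simp
        moreover have "k \<le> Suc x + 1" "Suc x + 1 - k = 2 * n"
          using x Suc by simp_all
        ultimately show ?thesis
          by (simp add: pmf_swap_chain_index_Suc distrib_right)
      qed
    qed
  qed
qed

end

section \<open>Unfolding the law into the two binomial terms\<close>

theorem corollary1:
  fixes a b :: complex and x :: nat
  assumes "(cmod a)\<^sup>2 + (cmod b)\<^sup>2 = 1"
    and "x \<ge> 1"
  shows "(\<forall>n::nat. real n < (real x + 1) / 2 \<longrightarrow>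
            measure_pmf.prob (swap_chain a b x) {A. is_eta a b (x + 1 - 2 * n) A} =
              real ((x + 1) choose n) *
                (cmod a ^ (2 * (x + 1 - n)) * cmod b ^ (2 * n)
                 + cmod a ^ (2 * n) * cmod b ^ (2 * (x + 1 - n)))) \<and>
         (odd x \<longrightarrow>
            measure_pmf.prob (swap_chain a b x) {A. is_eta a b 0 A} =
              real ((x + 1) choose ((x + 1) div 2)) * cmod a ^ (x + 1) * cmod b ^ (x + 1))"
proof (intro conjI allI impI)
  fix n :: nat assume "real n < (real x + 1) / 2"
  then have "real (2 * n) < real (x + 1)"
    by simp
  then have "2 * n < x + 1"
    by (simp only: of_nat_less_iff)
  then have le: "2 * n \<le> x + 1" and ne: "x + 1 - 2 * n \<noteq> 0"
    and e: "x + 1 - (x + 1 - 2 * n) = 2 * n" and split: "x + 1 - n = (x + 1 - 2 * n) + n"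
    by auto
  have "measure_pmf.prob (swap_chain a b x) {A. is_eta a b (x + 1 - 2 * n) A} =
      real ((x + 1) choose n) * (cmod a * cmod b) ^ (2 * n) * (eta_norm a b (x + 1 - 2 * n))\<^sup>2"
    unfolding prob_swap_chain_is_eta[OF assms(1)] pmf_swap_chain_index[OF assms(1)] e
    using ne by simp
  \<comment> \<open>Expanding n_k^2 = |a|^(2k) + |b|^(2k) at k = x + 1 - 2n gives the two terms,
    since 2n + 2k = 2(x + 1 - n).\<close>
  then show "measure_pmf.prob (swap_chain a b x) {A. is_eta a b (x + 1 - 2 * n) A} =
      real ((x + 1) choose n) *
        (cmod a ^ (2 * (x + 1 - n)) * cmod b ^ (2 * n)
         + cmod a ^ (2 * n) * cmod b ^ (2 * (x + 1 - n)))"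
    unfolding eta_norm_sq[OF assms(1)] split
    by (simp only: distrib_left power_add power_mult_distrib mult_ac)
next
  assume "odd x"
  then show "measure_pmf.prob (swap_chain a b x) {A. is_eta a b 0 A} =
      real ((x + 1) choose ((x + 1) div 2)) * cmod a ^ (x + 1) * cmod b ^ (x + 1)"
    unfolding prob_swap_chain_is_eta[OF assms(1)] pmf_swap_chain_index[OF assms(1)]
    by (simp add: power_mult_distrib)
qed

end
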